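(* Let $s$, $\bar\theta$ and the tie-line multiplier $\bar\eta$ be taken from an optimal primal-dual solution of the look-ahead GCTS clearing problem of a two-area network. For $i\in\{1,2\}$, assume that the real-time dispatch problem of Area $i$ (with boundary angles fixed at $\bar\theta$ and real-time loads $d_i^R$, possibly different from the look-ahead loads) is feasible, and let $g_i$ together with the multipliers $\lambda_i^R,\bar\lambda_i^R,\eta_i^R$ be an optimal primal-dual solution of it. Suppose internal bids are settled at prices $\lambda_i^R$ and interface bids pay $\mu_i^R+\tfrac12\rho$ per unit in Area $i$. Then the net revenue of Area $i$ equals its congestion rent and is non-negative: $$(d_i^R-g_i)^T\lambda_i^R+s^T\Big(\mu_i^R+\tfrac{\rho}{2}\Big)=f_i^T\eta_i^R+\tfrac12\bar f^T\bar\eta\;\ge 0 .$$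
   Context: Network (DC power flow model). A connected network is partitioned into two areas $i=1,2$. A tie-line is a line joining the two areas. A boundary bus is a bus to which a tie-line is attached; the other buses are internal. Boundary buses carry no generation or load; each internal bus has one generator and one load. For area $i$: $g_i$ is the vector of generations, $d_i$ the look-ahead (predicted) loads, $d_i^R$ the real-time loads, $\theta_i$ the internal phase angles, $\bar\theta_i$ the boundary phase angles, $\bar\theta=(\bar\theta_1,\bar\theta_2)$. One boundary bus is the reference, with angle fixed to $0$. The matrix $Y$ is the graph Laplacian weighted by reciprocals of the (positive) branch reactances, with blocks $Y_{ii}$, $Y_{i\bar i},Y_{\bar i i}$, $Y_{\bar i\bar i}$, $Y_{\bar1\bar2},Y_{\bar2\bar1}$ (index $i$ = internal buses of area $i$, index $\bar i$ = its boundary buses). Internal buses of one area are not adjacent to buses of the other area. Put $\tilde Y_{\bar i\bar i}=Y_{\bar i\bar i}-Y_{\bar i i}Y_{ii}^{-1}Y_{i\bar i}$ and $$\tilde Y=\begin{bmatrix} \tilde Y_{\bar1\bar1} & Y_{\bar1\bar2} \\ Y_{\bar2\bar1} & \tilde Y_{\bar2\bar2} \end{bmatrix}.$$ In expressions involving $\tilde Y^{-1}$, the row and column of the reference bus are removed from $\tilde Y$ (so it is invertible), and correspondingly the reference-bus entries of $M$, $\bar\theta$, gradients with respect to $\bar\theta$, and $[\bar H_{\bar1}\ \bar H_{\bar2}]$ are removed. Interface bids. A bid buys at a boundary bus of one area and sells the same amount at a boundary bus of the other; it has price $\Delta\pi_k$ and maximum quantity $s_{\max,k}$. $M_i$ has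 one row per boundary bus of area $i$ and one column per bid, with entry $1$ if the bid buys there, $-1$ if it sells there, $0$ otherwise; $M=[M_1;M_2]$. Look-ahead GCTS clearing problem: minimize $c_1(g_1)+c_2(g_2)+\Delta\pi^Ts$ over $g_i,s,\theta_i,\bar\theta$ subject to $\check g_i\le g_i\le\hat g_i$; $0\le s\le s_{\max}$; $H_i\theta_i+H_{\bar i}\bar\theta_i\le f_i$ ($i=1,2$); $\bar H_{\bar1}\bar\theta_1+\bar H_{\bar2}\bar\theta_2\le\bar f$ (multiplier $\bar\eta\ge0$); the power flow equations $Y_{ii}\theta_i+Y_{i\bar i}\bar\theta_i=g_i-d_i$ and $Y_{\bar ii}\theta_i+Y_{\bar i\bar i}\bar\theta_i+Y_{\bar i\bar j}\bar\theta_j=0$ for $i=1,2$, $j\ne i$; and $\tilde Y\bar\theta=Ms$. The costs $c_i$ are real-valued convex functions; $f_i\ge0$ and $\bar f\ge0$ are line capacities; the rows of $H_i,H_{\bar i}$ (resp. $\bar H_{\bar1},\bar H_{\bar2}$) give signed internal line (resp. tie-line) flows. Real-time dispatch of Area $i$ ($j\neq i$): with $\bar\theta$ fixed, minimize $c_i(g_i)$ over $g_i,\theta_i$ subject to $H_i\theta_i+H_{\bar i}\bar\theta_i\le f_i$ (multiplier $\eta_i^R\ge0$); $\check g_i\le g_i\le\hat g_i$; $Y_{ii}\theta_i+Y_{i\bar i}\bar\theta_i=g_i-d_i^R$ (multiplier $\lambda_i^R$); $Y_{\bar ii}\theta_i+Y_{\bar i\bar i}\bar\theta_i+Y_{\bar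 i\bar j}\bar\theta_j=0$ (multiplier $\bar\lambda_i^R$). Sign convention: for an equality constraint $a=b$ written above the Lagrangian contains (multiplier)$^T(a-b)$, and for an inequality $a\le b$ it contains (multiplier)$^T(a-b)$; thus $\lambda_i^R$ is the vector of locational marginal prices. Settlement prices. Let $\nabla_{\bar\theta}c_i^*$ be the vector whose $\bar\theta_i$-block is $Y_{\bar ii}\lambda_i^R+Y_{\bar i\bar i}\bar\lambda_i^R+H_{\bar i}^T\eta_i^R$ and whose $\bar\theta_j$-block is $Y_{\bar j\bar i}\bar\lambda_i^R$. Define $$\mu_i^R=M^T\tilde Y^{-1}\nabla_{\bar\theta}c_i^*,\qquad \rho=M^T\tilde S^T\bar\eta,\qquad \tilde S=[\bar H_{\bar1}\ \ \bar H_{\bar2}]\,\tilde Y^{-1}.$$ Loads pay and generators are paid $\lambda_i^R$; interface bids pay $\mu_i^R+\rho/2$ to Area $i$. The net revenue of Area $i$ is the total collected from internal and interface participants. Its congestion rent is the internal congestion rent $f_i^T\eta_i^R$ plus half of the tie-line congestion rent $\bar f^T\bar\eta$. *)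

theory Defs
  imports "HOL-Analysis.Analysis"
begin

section \<open>Vectors and matrices indexed by subsets of a finite type\<close>

text \<open>
  A vector indexed by a subset \<open>S\<close> of a finite type is a vector over the whole type that vanishes
  off \<open>S\<close>; a matrix block is zero off its rows and columns. Products of conforming blocks are then
  the library products, and a block \<open>A\<close> with columns \<open>C\<close> only sees the \<open>C\<close>-part of \<open>x\<close> in
  \<open>A *v x\<close>.
\<close>

definition vecs :: "'n set \<Rightarrow> (real ^ 'n::finite) set" where
  "vecs S = {x. \<forall>j. j \<notin> S \<longrightarrow> x $ j = 0}"

definition restr :: "'n set \<Rightarrow> real ^ 'n::finite \<Rightarrow> real ^ 'n" where
  "restr S x = (\<chi> j. if j \<in> S then x $ j else 0)"

definition block :: "'m set \<Rightarrow> 'n set \<Rightarrow> real ^ 'n::finite ^ 'm::finite \<Rightarrow> real ^ 'n ^ 'm" where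
  "block R C A = (\<chi> r c. if r \<in> R \<and> c \<in> C then A $ r $ c else 0)"

text \<open>
  Inverse of the principal submatrix of \<open>A\<close> on \<open>S\<close>: the submatrix is completed by the identity on
  the complement of \<open>S\<close>, inverted, and cut back to \<open>S\<close>. Rows and columns of \<open>A\<close> outside \<open>S\<close>
  are thus removed.
\<close>

definition block_inv :: "'n set \<Rightarrow> real ^ 'n::finite ^ 'n \<Rightarrow> real ^ 'n ^ 'n" where
  "block_inv S A = block S S (matrix_inv (block S S A + block (- S) (- S) (mat 1)))"


section \<open>Optimal primal-dual solutions\<close>

text \<open>
  \<open>X\<close> is the space of the primal variables, \<open>F \<subseteq> X\<close> the feasible set, \<open>L\<close> the Lagrangian and
  \<open>\<Lambda>\<close> the set of admissible multipliers (of the right dimensions, nonnegative for inequalities).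
\<close>

definition dual_fun :: "'x set \<Rightarrow> ('x \<Rightarrow> 'm \<Rightarrow> real) \<Rightarrow> 'm \<Rightarrow> ereal" where
  "dual_fun X L m = (INF x\<in>X. ereal (L x m))"

definition primal_dual_optimal ::
  "'x set \<Rightarrow> 'x set \<Rightarrow> ('x \<Rightarrow> real) \<Rightarrow> 'm set \<Rightarrow> ('x \<Rightarrow> 'm \<Rightarrow> real) \<Rightarrow> 'x \<Rightarrow> 'm \<Rightarrow> bool" where
  "primal_dual_optimal X F obj \<Lambda> L x m \<longleftrightarrow>
     is_arg_min obj (\<lambda>x. x \<in> F) x \<and>
     is_arg_max (dual_fun X L) (\<lambda>m. m \<in> \<Lambda>) m \<and>
     dual_fun X L m = ereal (obj x)"


section \<open>The network\<close>

datatype area = Area1 | Area2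

fun other :: "area \<Rightarrow> area" where
  "other Area1 = Area2"
| "other Area2 = Area1"

text \<open>
  Buses \<open>'v\<close>, branches \<open>'l\<close> (parallel branches allowed), rows \<open>'r\<close> of the line-limit constraints,
  interface bids \<open>'k\<close>. Every row limits the flow of one branch in one direction (\<open>rsign = 1\<close>:
  from \<open>src\<close> to \<open>tgt\<close>), so a branch limited in both directions has two rows.
\<close>

record ('v::finite, 'l::finite, 'r::finite, 'k::finite) gcts =
  area_of :: "'v \<Rightarrow> area"
  src     :: "'l \<Rightarrow> 'v"
  tgt     :: "'l \<Rightarrow> 'v"
  react   :: "'l \<Rightarrow> real"
  ref_bus :: "'v"
  rline   :: "'r \<Rightarrow> 'l"
  rsign   :: "'r \<Rightarrow> real"
  cap     :: "real ^ 'r"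
  buy     :: "'k \<Rightarrow> 'v"
  sell    :: "'k \<Rightarrow> 'v"
  price   :: "real ^ 'k"
  smax    :: "real ^ 'k"
  cost    :: "area \<Rightarrow> real ^ 'v \<Rightarrow> real"
  gmin    :: "area \<Rightarrow> real ^ 'v"
  gmax    :: "area \<Rightarrow> real ^ 'v"
  load    :: "area \<Rightarrow> real ^ 'v"

definition tie_line :: "('v::finite,'l::finite,'r::finite,'k::finite) gcts \<Rightarrow> 'l \<Rightarrow> bool" where
  "tie_line N l \<longleftrightarrow> area_of N (src N l) \<noteq> area_of N (tgt N l)"

definition boundary :: "('v::finite,'l::finite,'r::finite,'k::finite) gcts \<Rightarrow> area \<Rightarrow> 'v set" where
  "boundary N i = {v. area_of N v = i \<and> (\<exists>l. tie_line N l \<and> v \<in> {src N l, tgt N l})}"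

definition internal :: "('v::finite,'l::finite,'r::finite,'k::finite) gcts \<Rightarrow> area \<Rightarrow> 'v set" where
  "internal N i = {v. area_of N v = i} - boundary N i"

definition all_boundary :: "('v::finite,'l::finite,'r::finite,'k::finite) gcts \<Rightarrow> 'v set" where
  "all_boundary N = boundary N Area1 \<union> boundary N Area2"

definition int_rows :: "('v::finite,'l::finite,'r::finite,'k::finite) gcts \<Rightarrow> area \<Rightarrow> 'r set" where
  "int_rows N i = {r. area_of N (src N (rline N r)) = i \<and> area_of N (tgt N (rline N r)) = i}"

definition tie_rows :: "('v::finite,'l::finite,'r::finite,'k::finite) gcts \<Rightarrow> 'r set" where
  "tie_rows N = {r. tie_line N (rline N r)}"

definition adj_rel :: "('v::finite,'l::finite,'r::finite,'k::finite) gcts \<Rightarrow> ('v \<times> 'v) set" where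
  "adj_rel N = (\<Union>l. {(src N l, tgt N l), (tgt N l, src N l)})"

definition gcts_network :: "('v::finite,'l::finite,'r::finite,'k::finite) gcts \<Rightarrow> bool" where
  "gcts_network N \<longleftrightarrow>
     (\<forall>l. src N l \<noteq> tgt N l \<and> react N l > 0) \<and>
     (\<forall>u v. (u, v) \<in> (adj_rel N)\<^sup>*) \<and>
     ref_bus N \<in> all_boundary N \<and>
     (\<forall>r. rsign N r \<in> {1, - 1}) \<and>
     0 \<le> cap N \<and>
     (\<forall>k. buy N k \<in> all_boundary N \<and> sell N k \<in> all_boundary N \<and>
          area_of N (buy N k) \<noteq> area_of N (sell N k)) \<and>
     (\<forall>i. convex_on (vecs (internal N i)) (cost N i) \<and>
          gmin N i \<in> vecs (internal N i) \<and> gmax N i \<in> vecs (internal N i) \<and>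
          load N i \<in> vecs (internal N i))"


section \<open>Network matrices\<close>

definition Ymat :: "('v::finite,'l::finite,'r::finite,'k::finite) gcts \<Rightarrow> real ^ 'v ^ 'v" where
  "Ymat N = (\<chi> u v.
     if u = v then (\<Sum>l | u \<in> {src N l, tgt N l}. 1 / react N l)
     else - (\<Sum>l | {src N l, tgt N l} = {u, v}. 1 / react N l))"

definition flow_mat :: "('v::finite,'l::finite,'r::finite,'k::finite) gcts \<Rightarrow> real ^ 'v ^ 'r" where
  "flow_mat N = (\<chi> r v. rsign N r / react N (rline N r) *
     (if v = src N (rline N r) then 1 else if v = tgt N (rline N r) then - 1 else 0))"

definition bid_mat :: "('v::finite,'l::finite,'r::finite,'k::finite) gcts \<Rightarrow> real ^ 'k ^ 'v" where
  "bid_mat N = (\<chi> v k. if v = buy N k then 1 else if v = sell N k then - 1 else 0)"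

text \<open>
  \<open>Y_II N i\<close>, \<open>Y_IB N i\<close>, \<open>Y_BI N i\<close>, \<open>Y_BB N i j\<close> stand for \<open>Y\<close> with index pairs
  (internal \<open>i\<close>, internal \<open>i\<close>), (internal \<open>i\<close>, boundary \<open>i\<close>), (boundary \<open>i\<close>, internal \<open>i\<close>),
  (boundary \<open>i\<close>, boundary \<open>j\<close>).
\<close>

definition Y_II :: "('v::finite,'l::finite,'r::finite,'k::finite) gcts \<Rightarrow> area \<Rightarrow> real ^ 'v ^ 'v" where
  "Y_II N i = block (internal N i) (internal N i) (Ymat N)"

definition Y_IB :: "('v::finite,'l::finite,'r::finite,'k::finite) gcts \<Rightarrow> area \<Rightarrow> real ^ 'v ^ 'v" where
  "Y_IB N i = block (internal N i) (boundary N i) (Ymat N)"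

definition Y_BI :: "('v::finite,'l::finite,'r::finite,'k::finite) gcts \<Rightarrow> area \<Rightarrow> real ^ 'v ^ 'v" where
  "Y_BI N i = block (boundary N i) (internal N i) (Ymat N)"

definition Y_BB ::
  "('v::finite,'l::finite,'r::finite,'k::finite) gcts \<Rightarrow> area \<Rightarrow> area \<Rightarrow> real ^ 'v ^ 'v" where
  "Y_BB N i j = block (boundary N i) (boundary N j) (Ymat N)"

definition H_I :: "('v::finite,'l::finite,'r::finite,'k::finite) gcts \<Rightarrow> area \<Rightarrow> real ^ 'v ^ 'r" where
  "H_I N i = block (int_rows N i) (internal N i) (flow_mat N)"

definition H_B :: "('v::finite,'l::finite,'r::finite,'k::finite) gcts \<Rightarrow> area \<Rightarrow> real ^ 'v ^ 'r" where
  "H_B N i = block (int_rows N i) (boundary N i) (flow_mat N)"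

definition H_T :: "('v::finite,'l::finite,'r::finite,'k::finite) gcts \<Rightarrow> area \<Rightarrow> real ^ 'v ^ 'r" where
  "H_T N i = block (tie_rows N) (boundary N i) (flow_mat N)"

definition int_cap :: "('v::finite,'l::finite,'r::finite,'k::finite) gcts \<Rightarrow> area \<Rightarrow> real ^ 'r" where
  "int_cap N i = restr (int_rows N i) (cap N)"

definition tie_cap :: "('v::finite,'l::finite,'r::finite,'k::finite) gcts \<Rightarrow> real ^ 'r" where
  "tie_cap N = restr (tie_rows N) (cap N)"

definition Ytil_BB :: "('v::finite,'l::finite,'r::finite,'k::finite) gcts \<Rightarrow> area \<Rightarrow> real ^ 'v ^ 'v" where
  "Ytil_BB N i = Y_BB N i i - Y_BI N i ** block_inv (internal N i) (Y_II N i) ** Y_IB N i"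

definition Ytil :: "('v::finite,'l::finite,'r::finite,'k::finite) gcts \<Rightarrow> real ^ 'v ^ 'v" where
  "Ytil N = Ytil_BB N Area1 + Y_BB N Area1 Area2 + Y_BB N Area2 Area1 + Ytil_BB N Area2"

text \<open>
  The result is zero in the row and column of the reference bus, so multiplying by it drops the
  reference entries of the other factors.
\<close>

definition Ytil_inv :: "('v::finite,'l::finite,'r::finite,'k::finite) gcts \<Rightarrow> real ^ 'v ^ 'v" where
  "Ytil_inv N = block_inv (all_boundary N - {ref_bus N}) (Ytil N)"


section \<open>Look-ahead clearing problem\<close>

record ('v::finite, 'k::finite) la_primal =
  la_g   :: "area \<Rightarrow> real ^ 'v"
  la_s   :: "real ^ 'k"
  la_th  :: "area \<Rightarrow> real ^ 'v"
  la_thb :: "real ^ 'v"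

record ('v::finite, 'r::finite, 'k::finite) la_dual =
  la_glo    :: "area \<Rightarrow> real ^ 'v"
  la_gup    :: "area \<Rightarrow> real ^ 'v"
  la_slo    :: "real ^ 'k"
  la_sup    :: "real ^ 'k"
  la_eta    :: "area \<Rightarrow> real ^ 'r"
  la_etabar :: "real ^ 'r"
  la_lam    :: "area \<Rightarrow> real ^ 'v"
  la_lambar :: "area \<Rightarrow> real ^ 'v"
  la_nu     :: "real ^ 'v"

text \<open>The reference angle is not a variable.\<close>

definition la_space ::
  "('v::finite,'l::finite,'r::finite,'k::finite) gcts \<Rightarrow> ('v,'k) la_primal set" where
  "la_space N = {x. (\<forall>i. la_g x i \<in> vecs (internal N i) \<and> la_th x i \<in> vecs (internal N i)) \<and>
                    la_thb x \<in> vecs (all_boundary N - {ref_bus N})}"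

definition la_feasible ::
  "('v::finite,'l::finite,'r::finite,'k::finite) gcts \<Rightarrow> ('v,'k) la_primal set" where
  "la_feasible N = {x \<in> la_space N.
     (\<forall>i. gmin N i \<le> la_g x i \<and> la_g x i \<le> gmax N i \<and>
          H_I N i *v la_th x i + H_B N i *v la_thb x \<le> int_cap N i \<and>
          Y_II N i *v la_th x i + Y_IB N i *v la_thb x = la_g x i - load N i \<and>
          Y_BI N i *v la_th x i + Y_BB N i i *v la_thb x + Y_BB N i (other i) *v la_thb x = 0) \<and>
     0 \<le> la_s x \<and> la_s x \<le> smax N \<and>
     H_T N Area1 *v la_thb x + H_T N Area2 *v la_thb x \<le> tie_cap N \<and>
     Ytil N *v la_thb x = bid_mat N *v la_s x}"

definition la_obj ::
  "('v::finite,'l::finite,'r::finite,'k::finite) gcts \<Rightarrow> ('v,'k) la_primal \<Rightarrow> real" where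
  "la_obj N x = cost N Area1 (la_g x Area1) + cost N Area2 (la_g x Area2) + price N \<bullet> la_s x"

definition la_multipliers ::
  "('v::finite,'l::finite,'r::finite,'k::finite) gcts \<Rightarrow> ('v,'r,'k) la_dual set" where
  "la_multipliers N = {m.
     (\<forall>i. la_glo m i \<in> vecs (internal N i) \<and> 0 \<le> la_glo m i \<and>
          la_gup m i \<in> vecs (internal N i) \<and> 0 \<le> la_gup m i \<and>
          la_eta m i \<in> vecs (int_rows N i) \<and> 0 \<le> la_eta m i \<and>
          la_lam m i \<in> vecs (internal N i) \<and> la_lambar m i \<in> vecs (boundary N i)) \<and>
     0 \<le> la_slo m \<and> 0 \<le> la_sup m \<and>
     la_etabar m \<in> vecs (tie_rows N) \<and> 0 \<le> la_etabar m \<and>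
     la_nu m \<in> vecs (all_boundary N)}"

definition la_lagrangian ::
  "('v::finite,'l::finite,'r::finite,'k::finite) gcts \<Rightarrow>
   ('v,'k) la_primal \<Rightarrow> ('v,'r,'k) la_dual \<Rightarrow> real" where
  "la_lagrangian N x m = la_obj N x +
     (\<Sum>i\<in>{Area1, Area2}.
        la_glo m i \<bullet> (gmin N i - la_g x i) + la_gup m i \<bullet> (la_g x i - gmax N i) +
        la_eta m i \<bullet> (H_I N i *v la_th x i + H_B N i *v la_thb x - int_cap N i) +
        la_lam m i \<bullet> (Y_II N i *v la_th x i + Y_IB N i *v la_thb x - (la_g x i - load N i)) +
        la_lambar m i \<bullet> (Y_BI N i *v la_th x i + Y_BB N i i *v la_thb x
                              + Y_BB N i (other i) *v la_thb x)) +
     la_slo m \<bullet> (0 - la_s x) + la_sup m \<bullet> (la_s x - smax N) +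
     la_etabar m \<bullet> (H_T N Area1 *v la_thb x + H_T N Area2 *v la_thb x - tie_cap N) +
     la_nu m \<bullet> (Ytil N *v la_thb x - bid_mat N *v la_s x)"

definition la_optimal ::
  "('v::finite,'l::finite,'r::finite,'k::finite) gcts \<Rightarrow>
   ('v,'k) la_primal \<Rightarrow> ('v,'r,'k) la_dual \<Rightarrow> bool" where
  "la_optimal N = primal_dual_optimal (la_space N) (la_feasible N) (la_obj N)
                    (la_multipliers N) (la_lagrangian N)"


section \<open>Real-time dispatch\<close>

record ('v::finite) rt_primal =
  rt_g  :: "real ^ 'v"
  rt_th :: "real ^ 'v"

record ('v::finite, 'r::finite) rt_dual =
  rt_glo    :: "real ^ 'v"
  rt_gup    :: "real ^ 'v"
  rt_eta    :: "real ^ 'r"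
  rt_lam    :: "real ^ 'v"
  rt_lambar :: "real ^ 'v"

definition rt_space ::
  "('v::finite,'l::finite,'r::finite,'k::finite) gcts \<Rightarrow> area \<Rightarrow> 'v rt_primal set" where
  "rt_space N i = {x. rt_g x \<in> vecs (internal N i) \<and> rt_th x \<in> vecs (internal N i)}"

definition rt_feasible ::
  "('v::finite,'l::finite,'r::finite,'k::finite) gcts \<Rightarrow> area \<Rightarrow> real ^ 'v \<Rightarrow> real ^ 'v \<Rightarrow>
   'v rt_primal set" where
  "rt_feasible N i thb dR = {x \<in> rt_space N i.
     H_I N i *v rt_th x + H_B N i *v thb \<le> int_cap N i \<and>
     gmin N i \<le> rt_g x \<and> rt_g x \<le> gmax N i \<and>
     Y_II N i *v rt_th x + Y_IB N i *v thb = rt_g x - dR \<and>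
     Y_BI N i *v rt_th x + Y_BB N i i *v thb + Y_BB N i (other i) *v thb = 0}"

definition rt_multipliers ::
  "('v::finite,'l::finite,'r::finite,'k::finite) gcts \<Rightarrow> area \<Rightarrow> ('v,'r) rt_dual set" where
  "rt_multipliers N i = {m.
     rt_glo m \<in> vecs (internal N i) \<and> 0 \<le> rt_glo m \<and>
     rt_gup m \<in> vecs (internal N i) \<and> 0 \<le> rt_gup m \<and>
     rt_eta m \<in> vecs (int_rows N i) \<and> 0 \<le> rt_eta m \<and>
     rt_lam m \<in> vecs (internal N i) \<and> rt_lambar m \<in> vecs (boundary N i)}"

definition rt_lagrangian ::
  "('v::finite,'l::finite,'r::finite,'k::finite) gcts \<Rightarrow> area \<Rightarrow> real ^ 'v \<Rightarrow> real ^ 'v \<Rightarrow>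
   'v rt_primal \<Rightarrow> ('v,'r) rt_dual \<Rightarrow> real" where
  "rt_lagrangian N i thb dR x m = cost N i (rt_g x) +
     rt_eta m \<bullet> (H_I N i *v rt_th x + H_B N i *v thb - int_cap N i) +
     rt_glo m \<bullet> (gmin N i - rt_g x) + rt_gup m \<bullet> (rt_g x - gmax N i) +
     rt_lam m \<bullet> (Y_II N i *v rt_th x + Y_IB N i *v thb - (rt_g x - dR)) +
     rt_lambar m \<bullet> (Y_BI N i *v rt_th x + Y_BB N i i *v thb + Y_BB N i (other i) *v thb)"

definition rt_optimal ::
  "('v::finite,'l::finite,'r::finite,'k::finite) gcts \<Rightarrow> area \<Rightarrow> real ^ 'v \<Rightarrow> real ^ 'v \<Rightarrow>
   'v rt_primal \<Rightarrow> ('v,'r) rt_dual \<Rightarrow> bool" where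
  "rt_optimal N i thb dR =
     primal_dual_optimal (rt_space N i) (rt_feasible N i thb dR) (\<lambda>x. cost N i (rt_g x))
       (rt_multipliers N i) (rt_lagrangian N i thb dR)"


section \<open>Settlement prices\<close>

definition grad_c ::
  "('v::finite,'l::finite,'r::finite,'k::finite) gcts \<Rightarrow> area \<Rightarrow> ('v,'r) rt_dual \<Rightarrow> real ^ 'v" where
  "grad_c N i w =
     (Y_BI N i *v rt_lam w + Y_BB N i i *v rt_lambar w + transpose (H_B N i) *v rt_eta w) +
     Y_BB N (other i) i *v rt_lambar w"

definition mu_R ::
  "('v::finite,'l::finite,'r::finite,'k::finite) gcts \<Rightarrow> area \<Rightarrow> ('v,'r) rt_dual \<Rightarrow> real ^ 'k" where
  "mu_R N i w = transpose (bid_mat N) *v (Ytil_inv N *v grad_c N i w)"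

definition S_til :: "('v::finite,'l::finite,'r::finite,'k::finite) gcts \<Rightarrow> real ^ 'v ^ 'r" where
  "S_til N = (H_T N Area1 + H_T N Area2) ** Ytil_inv N"

definition rho ::
  "('v::finite,'l::finite,'r::finite,'k::finite) gcts \<Rightarrow> ('v,'r,'k) la_dual \<Rightarrow> real ^ 'k" where
  "rho N m = transpose (bid_mat N) *v (transpose (S_til N) *v la_etabar m)"

end

theory Submission
  imports Defs
begin

text \<open>
  The real-time Lagrangian is affine in \<open>\<theta>\<^sub>i\<close> and minimal at the optimum, so its value there does not
  change when \<open>\<theta>\<^sub>i\<close> is replaced by \<open>0\<close>. With complementary slackness this reads
  \<open>(d\<^sub>i - g\<^sub>i)\<^sup>T\<lambda>\<^sub>i + \<theta>\<^sup>T\<nabla>c\<^sub>i = f\<^sub>i\<^sup>T\<eta>\<^sub>i\<close>, where \<open>\<theta>\<close> is the vector of boundary angles.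
  The Laplacian of a connected network is definite on vectors vanishing at the reference bus, hence
  so is its Schur complement \<open>Ytil\<close>; being symmetric and invertible there, it turns \<open>Ytil \<theta> = M s\<close>
  into \<open>s\<^sup>T\<mu>\<^sub>i = \<theta>\<^sup>T\<nabla>c\<^sub>i\<close> and \<open>s\<^sup>T\<rho>\<close> into the tie-line flows weighted by their multipliers, which
  by look-ahead complementary slackness is the tie-line congestion rent.
\<close>

section \<open>Inner products and calculus of restricted vectors and blocks\<close>

lemma inner_diff_nonpos:
  fixes a p q :: "real ^ 'n::finite"
  assumes "0 \<le> a" "p \<le> q"
  shows "a \<bullet> (p - q) \<le> 0"
  using assms by (auto simp: inner_vec_def less_eq_vec_def intro!: sum_nonpos mult_nonneg_nonpos)

lemma inner_nonneg_vec:
  fixes a b :: "real ^ 'n::finite"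
  assumes "0 \<le> a" "0 \<le> b"
  shows "0 \<le> a \<bullet> b"
  using inner_diff_nonpos[OF assms] by simp

lemma inner_matrix_vector_transpose:
  fixes A :: "real ^ 'n::finite ^ 'm::finite"
  shows "a \<bullet> (A *v b) = (transpose A *v a) \<bullet> b"
  by (simp add: dot_lmul_matrix)

lemma inner_transpose_mult:
  fixes A :: "real ^ 'n::finite ^ 'm::finite"
  shows "b \<bullet> (transpose A *v a) = a \<bullet> (A *v b)"
  using inner_matrix_vector_transpose[of a A b] by (simp only: inner_commute)

lemma restr_nth [simp]: "restr S z $ j = (if j \<in> S then z $ j else 0)"
  by (simp add: restr_def)

lemma restr_in_vecs [simp]: "restr S z \<in> vecs S"
  by (simp add: vecs_def)

lemma restr_vecs: "z \<in> vecs S \<Longrightarrow> restr S z = z"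
  by (simp add: vecs_def vec_eq_iff)

lemma vecs_mono: "z \<in> vecs S \<Longrightarrow> S \<subseteq> T \<Longrightarrow> z \<in> vecs T"
  by (auto simp: vecs_def)

lemma vec_mult_minus: "A *v (- z) = - (A *v z :: real ^ 'm::finite)"
  by (simp add: vec_eq_iff matrix_vector_mult_def sum_negf)

lemma block_mult_vec: "block R C A *v z = restr R (A *v restr C z)"
  by (auto simp: vec_eq_iff matrix_vector_mult_def block_def intro!: sum.cong)

lemma transpose_block: "transpose (block R C A) = block C R (transpose A)"
  by (auto simp: vec_eq_iff transpose_def block_def)

lemma transpose_plus: "transpose (A + B) = transpose A + transpose B"
  by (simp add: vec_eq_iff transpose_def)

lemma transpose_minus: "transpose (A - B) = transpose A - transpose B"
  by (simp add: vec_eq_iff transpose_def)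

section \<open>Inverses of principal submatrices\<close>

lemma invertible_matrix_inv:
  fixes A :: "real ^ 'n::finite ^ 'n"
  assumes "invertible A"
  shows "A ** matrix_inv A = mat 1" "matrix_inv A ** A = mat 1"
  using someI_ex[OF assms[unfolded invertible_def]] by (auto simp: matrix_inv_def)

lemma transpose_matrix_inv:
  fixes A :: "real ^ 'n::finite ^ 'n"
  assumes "invertible A" "transpose A = A"
  shows "transpose (matrix_inv A) = matrix_inv A"
proof -
  have "transpose (matrix_inv A) ** A = mat 1"
    using arg_cong[OF invertible_matrix_inv(1)[OF assms(1)], of transpose] assms(2)
    by (simp add: matrix_transpose_mul)
  then have "transpose (matrix_inv A) ** (A ** matrix_inv A) = matrix_inv A"
    by (simp add: matrix_mul_assoc)
  then show ?thesis
    by (simp add: invertible_matrix_inv(1)[OF assms(1)])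
qed

text \<open>This is nonsingularity of the principal submatrix on \<open>S\<close>, phrased through
  its kernel because energy arguments for the Laplacian deliver exactly that.\<close>

definition nonsingular_on :: "'n set \<Rightarrow> real ^ 'n::finite ^ 'n \<Rightarrow> bool" where
  "nonsingular_on S A \<longleftrightarrow> (\<forall>z\<in>vecs S. restr S (A *v z) = 0 \<longrightarrow> z = 0)"

lemma completed_block_mult_vec:
  "(block S S A + block (- S) (- S) (mat 1)) *v z = restr S (A *v restr S z) + restr (- S) z"
  by (simp add: matrix_vector_mult_add_rdistrib block_mult_vec vec_eq_iff)

text \<open>The completed matrix is block diagonal: a kernel vector vanishes on \<open>S\<close> by
  nonsingularity there and off \<open>S\<close> because the other block is the identity.\<close>

lemma invertible_completed_block:
  fixes A :: "real ^ 'n::finite ^ 'n"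
  assumes "nonsingular_on S A"
  shows "invertible (block S S A + block (- S) (- S) (mat 1))" (is "invertible ?C")
proof -
  have "z = 0" if "?C *v z = 0" for z
  proof -
    have *: "(if j \<in> S then (A *v restr S z) $ j else z $ j) = 0" for j
      using arg_cong[OF that, of "\<lambda>v. v $ j"] unfolding completed_block_mult_vec
      by (auto split: if_splits)
    have "restr S (A *v restr S z) = 0"
    proof (rule vec_eq_iff[THEN iffD2, rule_format])
      fix j show "restr S (A *v restr S z) $ j = 0 $ j"
        using *[of j] by (auto split: if_splits)
    qed
    then have "restr S z = 0"
      using assms restr_in_vecs unfolding nonsingular_on_def by blast
    show "z = 0"
    proof (rule vec_eq_iff[THEN iffD2, rule_format])
      fix j show "z $ j = 0 $ j"
        using *[of j] arg_cong[OF \<open>restr S z = 0\<close>, of "\<lambda>v. v $ j"] by (auto split: if_splits)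
    qed
  qed
  then show ?thesis
    by (simp add: invertible_left_inverse matrix_left_invertible_ker)
qed

lemma block_inv_in_vecs: "block_inv S A *v z \<in> vecs S"
  by (simp add: block_inv_def block_mult_vec)

lemma restr_mult_block_inv:
  fixes A :: "real ^ 'n::finite ^ 'n"
  assumes "nonsingular_on S A"
  shows "restr S (A *v (block_inv S A *v z)) = restr S z"
proof -
  let ?C = "block S S A + block (- S) (- S) (mat 1)"
  \<comment> \<open>\<open>u\<close> solves the completed system on the whole space; its
    \<open>S\<close>-part solves the system of the submatrix.\<close>
  define u where "u = matrix_inv ?C *v restr S z"
  have "?C *v u = restr S z"
    by (simp only: u_def matrix_vector_mul_assoc matrix_vector_mul_lid
        invertible_matrix_inv(1)[OF invertible_completed_block[OF assms]])
  then have *: "restr S (A *v restr S u) + restr (- S) u = restr S z"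
    by (simp only: completed_block_mult_vec)
  have "block_inv S A *v z = restr S u"
    by (simp add: block_inv_def block_mult_vec u_def)
  moreover have "restr S (A *v restr S u) = restr S z"
  proof (rule vec_eq_iff[THEN iffD2, rule_format])
    fix j show "restr S (A *v restr S u) $ j = restr S z $ j"
      using arg_cong[OF *, of "\<lambda>v. v $ j"] by (auto split: if_splits)
  qed
  ultimately show ?thesis by simp
qed

text \<open>The candidate and \<open>z\<close> both lie in \<open>vecs S\<close> and have the same
  image on \<open>S\<close>, so nonsingularity identifies them. Entries of \<open>A *v z\<close> off
  \<open>S\<close> are ignored by \<open>block_inv\<close>.\<close>

lemma block_inv_mult_restr:
  fixes A :: "real ^ 'n::finite ^ 'n"
  assumes "nonsingular_on S A" "z \<in> vecs S"
  shows "block_inv S A *v (A *v z) = z"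
proof -
  let ?u = "block_inv S A *v (A *v z) - z"
  have "restr S (A *v ?u) = 0"
    using arg_cong[OF restr_mult_block_inv[OF assms(1), of "A *v z"], of "\<lambda>v. v - restr S (A *v z)"]
    by (simp add: vec_eq_iff matrix_vector_mult_diff_distrib split: if_splits)
  moreover have "?u \<in> vecs S"
    using block_inv_in_vecs[of S A "A *v z"] assms(2) by (simp add: vecs_def)
  ultimately have "?u = 0"
    using assms(1) unfolding nonsingular_on_def by blast
  then show ?thesis by simp
qed

lemma transpose_block_inv:
  fixes A :: "real ^ 'n::finite ^ 'n"
  assumes "nonsingular_on S A" "transpose A = A"
  shows "transpose (block_inv S A) = block_inv S A"
  unfolding block_inv_def transpose_block
  by (subst transpose_matrix_inv[OF invertible_completed_block[OF assms(1)]])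
    (simp_all add: transpose_plus transpose_block assms(2) transpose_mat)

text \<open>With no duality gap, the optimal cost bounds the Lagrangian from below on all of
  \<open>X\<close>, including infeasible points. Both slackness arguments start from this
  bound.\<close>

lemma primal_dual_optimalD:
  assumes "primal_dual_optimal X F obj \<Lambda> L x m"
  shows "x \<in> F" "m \<in> \<Lambda>" "x' \<in> X \<Longrightarrow> obj x \<le> L x' m"
proof -
  show "x \<in> F" "m \<in> \<Lambda>"
    using assms by (auto simp: primal_dual_optimal_def is_arg_min_def is_arg_max_def)
  assume "x' \<in> X"
  then have "dual_fun X L m \<le> ereal (L x' m)"
    unfolding dual_fun_def by (rule INF_lower)
  then show "obj x \<le> L x' m"
    using assms by (simp add: primal_dual_optimal_def)
qed

section \<open>The weighted Laplacian of the network\<close>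

text \<open>Factorization of the Laplacian through the signed incidence matrix. It relies on the
  absence of self-loops, which would add to the diagonal but have zero incidence.\<close>

lemma Ymat_nth:
  assumes "gcts_network N"
  shows "Ymat N $ u $ v = (\<Sum>l\<in>UNIV. 1 / react N l *
    (of_bool (u = src N l) - of_bool (u = tgt N l)) * (of_bool (v = src N l) - of_bool (v = tgt N l)))"
proof -
  have ne: "src N l \<noteq> tgt N l" for l
    using assms by (simp add: gcts_network_def)
  show ?thesis
  proof (cases "u = v")
    case True
    then show ?thesis
      by (auto simp: Ymat_def ne ne[symmetric] intro!: sum.mono_neutral_cong_left)
  next
    case False
    then show ?thesis
      by (auto simp: Ymat_def ne ne[symmetric] sum_negf[symmetric] doubleton_eq_iff intro!: sum.mono_neutral_cong_left)
  qed
qed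

lemma transpose_Ymat: "transpose (Ymat N) = Ymat N"
  by (simp add: vec_eq_iff transpose_def Ymat_def insert_commute)

lemma inner_Ymat:
  assumes "gcts_network N"
  shows "z \<bullet> (Ymat N *v z) = (\<Sum>l\<in>UNIV. (z $ src N l - z $ tgt N l)\<^sup>2 / react N l)"
proof -
  have inc: "(\<Sum>u\<in>UNIV. z $ u * (of_bool (u = src N l) - of_bool (u = tgt N l))) = z $ src N l - z $ tgt N l"
    for l
    by (simp add: right_diff_distrib sum_subtractf)
  have "z \<bullet> (Ymat N *v z) = (\<Sum>u\<in>UNIV. \<Sum>v\<in>UNIV. \<Sum>l\<in>UNIV. 1 / react N l *
      (z $ u * (of_bool (u = src N l) - of_bool (u = tgt N l))) *
      (z $ v * (of_bool (v = src N l) - of_bool (v = tgt N l))))"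
    by (simp add: inner_vec_def matrix_vector_mult_def Ymat_nth[OF assms] sum_distrib_left
        sum_distrib_right mult_ac)
  \<comment> \<open>With the branch index moved outermost, each summand factors into two incidence
    sums evaluated by \<open>inc\<close>.\<close>
  also have "\<dots> = (\<Sum>u\<in>UNIV. \<Sum>l\<in>UNIV. \<Sum>v\<in>UNIV. 1 / react N l *
      (z $ u * (of_bool (u = src N l) - of_bool (u = tgt N l))) *
      (z $ v * (of_bool (v = src N l) - of_bool (v = tgt N l))))"
    by (intro sum.cong refl sum.swap)
  also have "\<dots> = (\<Sum>l\<in>UNIV. \<Sum>u\<in>UNIV. \<Sum>v\<in>UNIV. 1 / react N l *
      (z $ u * (of_bool (u = src N l) - of_bool (u = tgt N l))) *
      (z $ v * (of_bool (v = src N l) - of_bool (v = tgt N l))))"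
    by (rule sum.swap)
  also have "\<dots> = (\<Sum>l\<in>UNIV. 1 / react N l * (z $ src N l - z $ tgt N l) * (z $ src N l - z $ tgt N l))"
    by (simp only: sum_distrib_left[symmetric] sum_distrib_right[symmetric] inc)
  finally show ?thesis
    by (simp add: power2_eq_square)
qed

text \<open>Zero energy forces equal angles at the two ends of every branch, since reactances are
  positive. Connectedness makes the angle constant, and it is zero at the reference bus.\<close>

lemma nonsingular_on_Ymat:
  assumes N: "gcts_network N" and ref: "ref_bus N \<notin> S"
  shows "nonsingular_on S (Ymat N)"
  unfolding nonsingular_on_def
proof (intro ballI impI)
  fix z assume z: "z \<in> vecs S" and 0: "restr S (Ymat N *v z) = 0"
  \<comment> \<open>Off \<open>S\<close> the first factor vanishes, on \<open>S\<close> the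
    second.\<close>
  have "z $ j * (Ymat N *v z) $ j = 0" for j
    using z arg_cong[OF 0, of "\<lambda>v. v $ j"] by (auto simp: vecs_def split: if_splits)
  then have "z \<bullet> (Ymat N *v z) = 0"
    unfolding inner_vec_def by (intro sum.neutral) simp
  moreover have pos: "react N l > 0" for l
    using N by (simp add: gcts_network_def)
  moreover have "0 \<le> (z $ src N l - z $ tgt N l)\<^sup>2 / react N l" for l
    using pos[of l] by simp
  ultimately have "(z $ src N l - z $ tgt N l)\<^sup>2 / react N l = 0" for l
    by (simp add: inner_Ymat[OF N] sum_nonneg_eq_0_iff)
  then have "z $ src N l = z $ tgt N l" for l
    using pos[of l] by (metis divide_eq_0_iff eq_iff_diff_eq_0 less_irrefl power_eq_0_iff)
  then have edge: "z $ u = z $ v" if "(u, v) \<in> adj_rel N" for u v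
    using that by (auto simp: adj_rel_def)
  have "z $ u = z $ v" if "(u, v) \<in> (adj_rel N)\<^sup>*" for u v
    using that by induction (simp_all add: edge)
  then have "z $ u = z $ ref_bus N" for u
    using N unfolding gcts_network_def by blast
  moreover have "z $ ref_bus N = 0"
    using z ref by (simp add: vecs_def)
  ultimately show "z = 0"
    by (metis vec_eq_iff zero_index)
qed

text \<open>A branch joining the two buses would be a tie-line and would make \<open>u\<close> a
  boundary bus.\<close>

lemma Ymat_internal_other:
  assumes "u \<in> internal N i" "area_of N v \<noteq> i"
  shows "Ymat N $ u $ v = 0" "Ymat N $ v $ u = 0"
proof -
  have no_line: "{l. {src N l, tgt N l} = {u, v}} = {}"
    using assms by (auto simp: internal_def boundary_def tie_line_def doubleton_eq_iff; metis)
  have "u \<noteq> v"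
    using assms by (auto simp: internal_def)
  then show "Ymat N $ u $ v = 0"
    unfolding Ymat_def vec_lambda_beta no_line by simp
  then show "Ymat N $ v $ u = 0"
    using arg_cong[OF transpose_Ymat[of N], of "\<lambda>A. A $ u $ v"] by (simp add: transpose_def)
qed

section \<open>The Schur complement \<open>Ytil\<close>\<close>

lemma ref_notin_internal: "gcts_network N \<Longrightarrow> ref_bus N \<notin> internal N i"
  by (auto simp: gcts_network_def all_boundary_def internal_def boundary_def)

lemma nonsingular_on_Y_II:
  assumes "gcts_network N"
  shows "nonsingular_on (internal N i) (Y_II N i)"
proof -
  have "restr (internal N i) (Y_II N i *v z) = restr (internal N i) (Ymat N *v z)"
    if "z \<in> vecs (internal N i)" for z
    using that by (simp add: Y_II_def block_mult_vec restr_vecs)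
  then show ?thesis
    using nonsingular_on_Ymat[OF assms ref_notin_internal[OF assms, of i]]
    unfolding nonsingular_on_def by metis
qed

lemma transpose_Ytil:
  assumes "gcts_network N"
  shows "transpose (Ytil N) = Ytil N"
proof -
  have "transpose (Y_II N i) = Y_II N i" for i
    by (simp add: Y_II_def transpose_block transpose_Ymat)
  note * = transpose_block_inv[OF nonsingular_on_Y_II[OF assms] this]
  have "transpose (Ytil_BB N i) = Ytil_BB N i" for i
    unfolding Ytil_BB_def transpose_minus matrix_transpose_mul * matrix_mul_assoc
    by (simp add: Y_BI_def Y_IB_def Y_BB_def transpose_block transpose_Ymat)
  then show ?thesis
    by (simp add: Ytil_def transpose_plus) (simp add: Y_BB_def transpose_block transpose_Ymat)
qed

text \<open>The internal angles that produce zero net injection at the internal buses when the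
  boundary angles are \<open>z\<close>.\<close>

definition int_resp :: "('v::finite,'l::finite,'r::finite,'k::finite) gcts \<Rightarrow> area \<Rightarrow> real ^ 'v \<Rightarrow> real ^ 'v" where
  "int_resp N i z = - (block_inv (internal N i) (Y_II N i) *v (Y_IB N i *v z))"

lemma int_resp_in_vecs: "int_resp N i z \<in> vecs (internal N i)"
  using block_inv_in_vecs[of "internal N i" "Y_II N i" "Y_IB N i *v z"]
  by (simp add: int_resp_def vecs_def)

lemma restr_internal_Ymat:
  assumes "z \<in> vecs {v. area_of N v \<noteq> i}"
  shows "restr (internal N i) (Ymat N *v z) = 0"
proof -
  have "Ymat N $ u $ v * z $ v = 0" if "u \<in> internal N i" for u v
    using assms Ymat_internal_other(1)[OF that, of v] by (cases "area_of N v = i") (auto simp: vecs_def)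
  then show ?thesis
    by (auto simp: vec_eq_iff matrix_vector_mult_def simp del: mult_eq_0_iff intro!: sum.neutral)
qed

lemma restr_boundary_Ymat:
  assumes "z \<in> vecs (internal N j)" "j \<noteq> i"
  shows "restr (boundary N i) (Ymat N *v z) = 0"
proof -
  have "Ymat N $ u $ v * z $ v = 0" if "u \<in> boundary N i" for u v
  proof (cases "v \<in> internal N j")
    case True
    then show ?thesis
      using Ymat_internal_other(2)[OF True, of u] that assms(2) by (auto simp: boundary_def)
  qed (use assms(1) in \<open>simp add: vecs_def\<close>)
  then show ?thesis
    by (auto simp: vec_eq_iff matrix_vector_mult_def simp del: mult_eq_0_iff intro!: sum.neutral)
qed

lemma restr_zero: "restr S 0 = 0"
  by (simp add: vec_eq_iff)

lemma restr_add: "restr S (a + b) = restr S a + restr S b"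
  by (simp add: vec_eq_iff)

lemma restr_minus: "restr S (- a) = - restr S a"
  by (simp add: vec_eq_iff)

lemma restr_restr: "restr S (restr T z) = restr (S \<inter> T) z"
  by (simp add: vec_eq_iff)

text \<open>The discrete harmonic extension of boundary angles to the interiors of both
  areas.\<close>

definition full_angles ::
  "('v::finite,'l::finite,'r::finite,'k::finite) gcts \<Rightarrow> real ^ 'v \<Rightarrow> real ^ 'v" where
  "full_angles N z = z + int_resp N Area1 z + int_resp N Area2 z"

lemma restr_full_angles:
  assumes "z \<in> vecs (all_boundary N)"
  shows "restr (all_boundary N) (full_angles N z) = z"
proof -
  have "restr (all_boundary N) (int_resp N i z) = 0" for i
    using int_resp_in_vecs[of N i z]
    by (cases i) (auto simp: vec_eq_iff vecs_def all_boundary_def internal_def boundary_def)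
  then show ?thesis
    using assms by (simp add: full_angles_def restr_add restr_vecs)
qed

lemma full_angles_split:
  assumes "i \<noteq> j"
  shows "full_angles N z = z + int_resp N i z + int_resp N j z"
  using assms by (cases i; cases j) (simp_all add: full_angles_def)

lemma int_resp_off_area: "i \<noteq> j \<Longrightarrow> int_resp N j z \<in> vecs {v. area_of N v \<noteq> i}"
  by (rule vecs_mono[OF int_resp_in_vecs]) (auto simp: internal_def)

lemma boundary_split:
  assumes "z \<in> vecs (all_boundary N)" "i \<noteq> j"
  shows "restr (boundary N i) z + restr (boundary N j) z = z"
  using assms by (cases i; cases j) (auto simp: vec_eq_iff vecs_def all_boundary_def boundary_def)

text \<open>Internal rows of area \<open>i\<close> see only angles of area \<open>i\<close>, and
  \<open>int_resp\<close> is chosen to cancel the contribution of its boundary angles.\<close>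

lemma restr_internal_full_angles:
  assumes N: "gcts_network N" and z: "z \<in> vecs (all_boundary N)"
  shows "restr (internal N i) (Ymat N *v full_angles N z) = 0"
proof -
  let ?I = "internal N i" and ?Y = "Ymat N"
  obtain j where ij: "i \<noteq> j"
    by (cases i) auto
  have "restr ?I (?Y *v int_resp N i z) = restr ?I (Y_II N i *v int_resp N i z)"
    by (simp add: Y_II_def block_mult_vec restr_restr restr_vecs[OF int_resp_in_vecs])
  also have "\<dots> = - restr ?I (Y_IB N i *v z)"
    by (simp add: int_resp_def vec_mult_minus restr_minus
        restr_mult_block_inv[OF nonsingular_on_Y_II[OF N]])
  also have "\<dots> = - restr ?I (?Y *v restr (boundary N i) z)"
    by (simp add: Y_IB_def block_mult_vec restr_restr)
  finally have 1: "restr ?I (?Y *v int_resp N i z) = - restr ?I (?Y *v restr (boundary N i) z)" .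
  note split = boundary_split[OF z ij]
  have "restr ?I (?Y *v z) = restr ?I (?Y *v restr (boundary N i) z) + restr ?I (?Y *v restr (boundary N j) z)"
    by (simp only: restr_add[symmetric] matrix_vector_right_distrib[symmetric] split)
  moreover have "restr ?I (?Y *v restr (boundary N j) z) = 0"
    using ij by (intro restr_internal_Ymat) (auto simp: vecs_def boundary_def)
  ultimately show ?thesis
    using restr_internal_Ymat[OF int_resp_off_area[OF ij, of N z]] 1
    by (simp add: full_angles_split[OF ij] matrix_vector_right_distrib restr_add)
qed

lemma restr_boundary_full_angles:
  assumes z: "z \<in> vecs (all_boundary N)" and ij: "i \<noteq> j"
  shows "restr (boundary N i) (Ymat N *v full_angles N z) = Ytil_BB N i *v z + Y_BB N i j *v z"
proof -
  let ?B = "boundary N i" and ?Y = "Ymat N"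
  note split = boundary_split[OF z ij]
  have "restr ?B (?Y *v z) = Y_BB N i i *v z + Y_BB N i j *v z"
    by (simp only: Y_BB_def block_mult_vec restr_add[symmetric] matrix_vector_right_distrib[symmetric] split)
  moreover have "restr ?B (?Y *v int_resp N i z) = Y_BI N i *v int_resp N i z"
    by (simp add: Y_BI_def block_mult_vec restr_vecs[OF int_resp_in_vecs])
  moreover have "Y_BI N i *v int_resp N i z = - ((Y_BI N i ** block_inv (internal N i) (Y_II N i) ** Y_IB N i) *v z)"
    by (simp add: int_resp_def vec_mult_minus matrix_vector_mul_assoc matrix_mul_assoc)
  moreover have "restr ?B (?Y *v int_resp N j z) = 0"
    using ij by (intro restr_boundary_Ymat[OF int_resp_in_vecs]) simp
  ultimately show ?thesis
    by (simp add: full_angles_split[OF ij] matrix_vector_right_distrib restr_add Ytil_BB_def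
        matrix_vector_mult_diff_rdistrib)
qed

text \<open>The Schur complement returns the boundary injections of the harmonic extension; this
  transfers properties of the Laplacian to \<open>Ytil\<close>.\<close>

lemma Ytil_mult_vec:
  assumes "z \<in> vecs (all_boundary N)"
  shows "Ytil N *v z = restr (all_boundary N) (Ymat N *v full_angles N z)"
proof -
  have "restr (all_boundary N) v = restr (boundary N Area1) v + restr (boundary N Area2) v" for v :: "real ^ 'a"
    by (auto simp: vec_eq_iff all_boundary_def boundary_def)
  then show ?thesis
    using restr_boundary_full_angles[OF assms, of Area1 Area2] restr_boundary_full_angles[OF assms, of Area2 Area1]
    by (simp add: Ytil_def matrix_vector_mult_add_rdistrib)
qed

text \<open>The harmonic extension of a kernel vector has zero injection at every bus except
  possibly the reference, and zero angle there, so nonsingularity of the grounded Laplacian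
  applies.\<close>

lemma nonsingular_on_Ytil:
  assumes N: "gcts_network N"
  shows "nonsingular_on (all_boundary N - {ref_bus N}) (Ytil N)" (is "nonsingular_on ?S _")
  unfolding nonsingular_on_def
proof (intro ballI impI)
  fix z assume zS: "z \<in> vecs ?S" and 0: "restr ?S (Ytil N *v z) = 0"
  have z: "z \<in> vecs (all_boundary N)"
    by (rule vecs_mono[OF zS]) simp
  let ?u = "full_angles N z"
  have "?u \<in> vecs (- {ref_bus N})"
    using zS ref_notin_internal[OF N] int_resp_in_vecs[of N _ z]
    by (simp add: full_angles_def vecs_def)
  moreover have "restr (- {ref_bus N}) (Ymat N *v ?u) = 0"
  proof (rule vec_eq_iff[THEN iffD2, rule_format])
    fix v
    \<comment> \<open>Internal rows vanish by harmonicity, the remaining boundary rows by assumption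
      \<open>0\<close>.\<close>
    have "v \<in> all_boundary N \<or> v \<in> internal N (area_of N v)"
      by (cases "area_of N v") (auto simp: all_boundary_def internal_def)
    then show "restr (- {ref_bus N}) (Ymat N *v ?u) $ v = 0 $ v"
      using arg_cong[OF restr_internal_full_angles[OF N z, of "area_of N v"], of "\<lambda>u. u $ v"]
        arg_cong[OF 0[unfolded Ytil_mult_vec[OF z]], of "\<lambda>u. u $ v"]
      by (auto split: if_splits)
  qed
  ultimately have "?u = 0"
    using nonsingular_on_Ymat[OF N, of "- {ref_bus N}"] unfolding nonsingular_on_def by blast
  then show "z = 0"
    using restr_full_angles[OF z] restr_zero by metis
qed

text \<open>\<open>Ytil_inv\<close> undoes the relation \<open>Ytil \<theta> = M s\<close> also when it acts on the left factor of an
  inner product, because it is symmetric.\<close>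

lemma inner_Ytil_inv:
  assumes N: "gcts_network N" and z: "z \<in> vecs (all_boundary N - {ref_bus N})"
  shows "(Ytil N *v z) \<bullet> (Ytil_inv N *v v) = z \<bullet> v"
proof -
  have "transpose (Ytil_inv N) = Ytil_inv N"
    unfolding Ytil_inv_def by (rule transpose_block_inv[OF nonsingular_on_Ytil[OF N] transpose_Ytil[OF N]])
  moreover have "Ytil_inv N *v (Ytil N *v z) = z"
    unfolding Ytil_inv_def by (rule block_inv_mult_restr[OF nonsingular_on_Ytil[OF N] z])
  ultimately show ?thesis
    by (metis inner_matrix_vector_transpose)
qed

section \<open>Complementary slackness and congestion rents\<close>

lemma int_cap_nonneg: "gcts_network N \<Longrightarrow> 0 \<le> int_cap N i"
  by (simp add: gcts_network_def int_cap_def less_eq_vec_def)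

lemma tie_cap_nonneg: "gcts_network N \<Longrightarrow> 0 \<le> tie_cap N"
  by (simp add: gcts_network_def tie_cap_def less_eq_vec_def)

text \<open>At a feasible point the Lagrangian adds only nonpositive terms to the objective, yet it
  is at least the objective. Hence each term is zero, in particular the tie-line term.\<close>

lemma la_tie_complementary_slackness:
  assumes "la_optimal N x m"
  shows "la_etabar m \<bullet> (H_T N Area1 *v la_thb x + H_T N Area2 *v la_thb x) = tie_cap N \<bullet> la_etabar m"
proof -
  note opt = primal_dual_optimalD[OF assms[unfolded la_optimal_def]]
  have feas: "x \<in> la_feasible N" and mul: "m \<in> la_multipliers N"
    by (rule opt)+
  have "la_obj N x \<le> la_lagrangian N x m"
    using feas by (intro opt) (simp add: la_feasible_def)
  moreover have "la_glo m i \<bullet> (gmin N i - la_g x i) \<le> 0" "la_gup m i \<bullet> (la_g x i - gmax N i) \<le> 0"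
    "la_eta m i \<bullet> (H_I N i *v la_th x i + H_B N i *v la_thb x - int_cap N i) \<le> 0" for i
    using feas mul by (auto simp: la_feasible_def la_multipliers_def intro!: inner_diff_nonpos)
  note this[of Area1] this[of Area2]
  moreover have "la_slo m \<bullet> (0 - la_s x) \<le> 0" "la_sup m \<bullet> (la_s x - smax N) \<le> 0"
    "la_etabar m \<bullet> (H_T N Area1 *v la_thb x + H_T N Area2 *v la_thb x - tie_cap N) \<le> 0"
    using feas mul by (auto simp: la_feasible_def la_multipliers_def intro!: inner_diff_nonpos simp del: diff_0)
  moreover have "la_lam m i \<bullet> (Y_II N i *v la_th x i + Y_IB N i *v la_thb x - (la_g x i - load N i)) = 0"
    "la_lambar m i \<bullet> (Y_BI N i *v la_th x i + Y_BB N i i *v la_thb x + Y_BB N i (other i) *v la_thb x) = 0" for i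
    using feas by (simp_all add: la_feasible_def)
  note this[of Area1] this[of Area2]
  moreover have "la_nu m \<bullet> (Ytil N *v la_thb x - bid_mat N *v la_s x) = 0"
    using feas by (simp add: la_feasible_def)
  ultimately have "la_etabar m \<bullet> (H_T N Area1 *v la_thb x + H_T N Area2 *v la_thb x - tie_cap N) = 0"
    unfolding la_lagrangian_def by simp
  then show ?thesis
    by (simp add: inner_diff_right inner_commute)
qed

text \<open>By symmetry of \<open>Ymat\<close>, this is the part of the real-time Lagrangian that is
  linear in the boundary angles, which justifies reading \<open>grad_c\<close> as a
  gradient.\<close>

lemma inner_grad_c:
  "z \<bullet> grad_c N i w = rt_lam w \<bullet> (Y_IB N i *v z)
     + rt_lambar w \<bullet> (Y_BB N i i *v z + Y_BB N i (other i) *v z) + rt_eta w \<bullet> (H_B N i *v z)"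
proof -
  have "Y_BI N i = transpose (Y_IB N i)" "Y_BB N j i = transpose (Y_BB N i j)" for j
    by (simp_all add: Y_IB_def Y_BI_def Y_BB_def transpose_block transpose_Ymat)
  then have "z \<bullet> (Y_BI N i *v a) = a \<bullet> (Y_IB N i *v z)"
    "z \<bullet> (Y_BB N j i *v a) = a \<bullet> (Y_BB N i j *v z)" for a j
    by (metis inner_transpose_mult)+
  then show ?thesis
    by (simp only: grad_c_def inner_add_right inner_transpose_mult)
qed

lemma rt_merchandising_surplus:
  assumes "rt_optimal N i thb dR y w"
  shows "(dR - rt_g y) \<bullet> rt_lam w + thb \<bullet> grad_c N i w = int_cap N i \<bullet> rt_eta w"
proof -
  note opt = primal_dual_optimalD[OF assms[unfolded rt_optimal_def]]
  have feas: "y \<in> rt_feasible N i thb dR" and mul: "w \<in> rt_multipliers N i"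
    by (rule opt)+
  \<comment> \<open>Scaling \<open>rt_th\<close> may violate the constraints but stays in
    \<open>rt_space\<close>, where the Lagrangian bound holds. The factors used are
    \<open>0\<close>, \<open>1\<close> and \<open>2\<close>; generation is kept fixed.\<close>
  have Y: "cost N i (rt_g y) \<le> rt_lagrangian N i thb dR (y\<lparr>rt_th := c *\<^sub>R rt_th y\<rparr>) w" for c
    using feas opt(3)[of "y\<lparr>rt_th := c *\<^sub>R rt_th y\<rparr>"]
    by (simp add: rt_feasible_def rt_space_def vecs_def)
  have "rt_glo w \<bullet> (gmin N i - rt_g y) \<le> 0" "rt_gup w \<bullet> (rt_g y - gmax N i) \<le> 0"
    "rt_eta w \<bullet> (H_I N i *v rt_th y + H_B N i *v thb - int_cap N i) \<le> 0"
    using feas mul by (auto simp: rt_feasible_def rt_multipliers_def intro!: inner_diff_nonpos)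
  moreover have "rt_lam w \<bullet> (Y_II N i *v rt_th y + Y_IB N i *v thb - (rt_g y - dR)) = 0"
    "rt_lambar w \<bullet> (Y_BI N i *v rt_th y + Y_BB N i i *v thb + Y_BB N i (other i) *v thb) = 0"
    using feas by (simp_all add: rt_feasible_def)
  ultimately have slack: "rt_glo w \<bullet> (gmin N i - rt_g y) = 0" "rt_gup w \<bullet> (rt_g y - gmax N i) = 0"
    and L1: "rt_lagrangian N i thb dR y w = cost N i (rt_g y)"
    using Y[of 1] by (simp_all add: rt_lagrangian_def)
  \<comment> \<open>The scale \<open>1\<close> is the midpoint of \<open>0\<close> and
    \<open>2\<close>. Two values bounded below by the cost whose average equals the cost must both
    equal it.\<close>
  have "rt_lagrangian N i thb dR (y\<lparr>rt_th := 0\<rparr>) w + rt_lagrangian N i thb dR (y\<lparr>rt_th := 2 *\<^sub>R rt_th y\<rparr>) w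
      = 2 * rt_lagrangian N i thb dR y w"
    by (simp add: rt_lagrangian_def inner_add_right inner_diff_right matrix_vector_mult_scaleR)
  then have "rt_lagrangian N i thb dR (y\<lparr>rt_th := 0\<rparr>) w = cost N i (rt_g y)"
    using Y[of 0] Y[of 2] L1 by simp
  \<comment> \<open>With \<open>rt_th\<close> set to \<open>0\<close>, the cost cancels and
    \<open>slack\<close> removes the generation limits; what remains is the balance of loads,
    generators and boundary angles.\<close>
  then show ?thesis
    unfolding inner_grad_c using slack
    by (simp add: rt_lagrangian_def inner_add_right inner_diff_right inner_diff_left inner_commute)
qed

theorem theorem3:
  fixes N :: "('v::finite, 'l::finite, 'r::finite, 'k::finite) gcts"
    and i :: area
    and x :: "('v, 'k) la_primal"
    and m :: "('v, 'r, 'k) la_dual"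
    and dR :: "real ^ 'v"
    and y :: "'v rt_primal"
    and w :: "('v, 'r) rt_dual"
  assumes "gcts_network N"
    and "la_optimal N x m"
    and "dR \<in> vecs (internal N i)"
    and "rt_feasible N i (la_thb x) dR \<noteq> {}"
    and "rt_optimal N i (la_thb x) dR y w"
  shows "(dR - rt_g y) \<bullet> rt_lam w + la_s x \<bullet> (mu_R N i w + (1/2) *\<^sub>R rho N m)
           = int_cap N i \<bullet> rt_eta w + 1/2 * (tie_cap N \<bullet> la_etabar m)
       \<and> int_cap N i \<bullet> rt_eta w + 1/2 * (tie_cap N \<bullet> la_etabar m) \<ge> 0"
proof -
  note la = primal_dual_optimalD[OF assms(2)[unfolded la_optimal_def]]
  have thb: "la_thb x \<in> vecs (all_boundary N - {ref_bus N})"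
    and bal: "Ytil N *v la_thb x = bid_mat N *v la_s x"
    using la(1) by (simp_all add: la_feasible_def la_space_def)
  \<comment> \<open>Moving the bid matrix onto \<open>la_s x\<close> produces \<open>M s\<close>,
    which the clearing constraint replaces by \<open>Ytil\<close> applied to the boundary
    angles.\<close>
  have bids: "la_s x \<bullet> (transpose (bid_mat N) *v v) = (Ytil N *v la_thb x) \<bullet> v" for v
    by (simp only: bal inner_transpose_mult inner_commute)
  have "la_s x \<bullet> mu_R N i w = la_thb x \<bullet> grad_c N i w"
    unfolding mu_R_def bids by (rule inner_Ytil_inv[OF assms(1) thb])
  moreover have "la_s x \<bullet> rho N m = tie_cap N \<bullet> la_etabar m"
  proof -
    let ?H = "H_T N Area1 + H_T N Area2"
    have "la_s x \<bullet> rho N m = la_etabar m \<bullet> (S_til N *v (Ytil N *v la_thb x))"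
      unfolding rho_def bids by (simp only: inner_transpose_mult)
    \<comment> \<open>The shift factor matrix ends in \<open>Ytil_inv\<close>, so applied to the
      boundary injections it recovers the boundary angles and then the tie-line flows.\<close>
    also have "S_til N *v (Ytil N *v la_thb x) = ?H *v (Ytil_inv N *v (Ytil N *v la_thb x))"
      by (simp only: S_til_def matrix_vector_mul_assoc matrix_mul_assoc)
    also have "Ytil_inv N *v (Ytil N *v la_thb x) = la_thb x"
      unfolding Ytil_inv_def by (rule block_inv_mult_restr[OF nonsingular_on_Ytil[OF assms(1)] thb])
    also have "la_etabar m \<bullet> (?H *v la_thb x) = tie_cap N \<bullet> la_etabar m"
      using la_tie_complementary_slackness[OF assms(2)] by (simp add: matrix_vector_mult_add_rdistrib)
    finally show ?thesis .
  qed
  moreover have "0 \<le> int_cap N i \<bullet> rt_eta w" "0 \<le> tie_cap N \<bullet> la_etabar m"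
    using primal_dual_optimalD(2)[OF assms(5)[unfolded rt_optimal_def]] la(2)
    by (auto simp: rt_multipliers_def la_multipliers_def int_cap_nonneg[OF assms(1)] tie_cap_nonneg[OF assms(1)]
        intro!: inner_nonneg_vec)
  ultimately show ?thesis
    using rt_merchandising_surplus[OF assms(5)] by (simp add: inner_add_right)
qed

end
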